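(* Let $H\sim\mathcal{N}(0,\Sigma)$ be a random $M\times N$ channel matrix (no separability assumption on $\Sigma$) and suppose $\mathcal{C}_\Sigma\neq\mathbb{C}\cdot\mathbf{1}_N$. Let $\{P_j\}_{j=1}^c$ be any resolution of identity consisting of minimal projections in $\mathcal{C}_\Sigma^t$, and let $U$ be any $N\times N$ unitary matrix whose columns consist of an orthonormal basis of $\mathrm{range}(P_1)$, followed by one of $\mathrm{range}(P_2)$, ..., followed by one of $\mathrm{range}(P_c)$ (so $U$ diagonalizes all $P_j$ simultaneously). Then there exists a capacity-achieving covariance matrix $Q$ (a maximizer of $C(Q)$ over $\{Q\ge0,\ \mathrm{tr}(Q)\le p\}$) of the form $Q=U\,\mathrm{diag}(Q_1,\dots,Q_c)\,U^H$ with $Q_j$ a square block of size $\mathrm{tr}(P_j)$; equivalently $QP_j=P_jQ$ for all $j$, so $Q$ maps each $\mathrm{range}(P_j)$ into itself.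
   Context: Fix integers $M,N\ge1$, noise variance $\sigma_n^2>0$ and power $p>0$. We identify $\mathbb{M}(M,\mathbb{C})\otimes\mathbb{M}(N,\mathbb{C})$ with $\mathbb{M}(MN,\mathbb{C})$ via $(A\otimes B)_{(i,j),(l,m)}=A_{il}B_{jm}$. $H\sim\mathcal{N}(0,\Sigma)$ means: $H$ is a random $M\times N$ complex matrix whose entries are jointly zero-mean circularly symmetric complex Gaussian (so $\mathcal{E}(H_{ij}H_{lm})=0$ for all indices), with covariance $\Sigma\in\mathbb{M}(M,\mathbb{C})\otimes\mathbb{M}(N,\mathbb{C})$ given by $\Sigma_{(i,j),(l,m)}=\mathcal{E}(H_{ij}\overline{H_{lm}})$. For positive semidefinite $Q\in\mathbb{M}(N,\mathbb{C})$ set $C(Q):=\mathcal{E}\big(\log\det(\mathbf{1}_M+\sigma_n^{-2}HQH^H)\big)$. The right commutant is $\mathcal{C}_\Sigma:=\{A\in\mathbb{M}(N,\mathbb{C}) : (\mathbf{1}_M\otimes A)\Sigma=\Sigma(\mathbf{1}_M\otimes A)\}$ (a unital $*$-algebra) and $\mathcal{C}_\Sigma^t:=\{A^t : A\in\mathcal{C}_\Sigma\}$. A projection means an orthogonal projection; a nonzero projection $P$ in a $*$-algebra $\mathcal{A}$ is minimal if every projection $Q\in\mathcal{A}$ with $Q\le P$ equals $0$ or $P$. A resolution of identity in $\mathcal{A}$ is a family of mutually orthogonal projections in $\mathcal{A}$ summing to $\mathbf{1}_N$. *)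

theory Defs
  imports "HOL-Probability.Probability"
begin

definition cadj :: "complex^'n::finite^'m::finite \<Rightarrow> complex^'m^'n" where
  "cadj A = (\<chi> i j. cnj (A $ j $ i))"

definition qform :: "complex^'n::finite^'n \<Rightarrow> complex^'n \<Rightarrow> complex" where
  "qform A x = (\<Sum>i\<in>UNIV. cnj (x $ i) * (A *v x) $ i)"

definition psd :: "complex^'n::finite^'n \<Rightarrow> bool" where
  "psd A \<longleftrightarrow> cadj A = A \<and> (\<forall>x. 0 \<le> Re (qform A x))"

definition loewner_le :: "complex^'n::finite^'n \<Rightarrow> complex^'n^'n \<Rightarrow> bool" where
  "loewner_le A B \<longleftrightarrow> psd (B - A)"

definition is_proj :: "complex^'n::finite^'n \<Rightarrow> bool" where
  "is_proj P \<longleftrightarrow> P ** P = P \<and> cadj P = P"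

definition unitary :: "complex^'n::finite^'n \<Rightarrow> bool" where
  "unitary U \<longleftrightarrow> cadj U ** U = mat 1 \<and> U ** cadj U = mat 1"

definition minimal_proj_in :: "(complex^'n::finite^'n) set \<Rightarrow> complex^'n^'n \<Rightarrow> bool" where
  "minimal_proj_in S P \<longleftrightarrow> P \<in> S \<and> is_proj P \<and> P \<noteq> 0 \<and>
     (\<forall>Q\<in>S. is_proj Q \<and> loewner_le Q P \<longrightarrow> Q = 0 \<or> Q = P)"

definition id_kron :: "complex^'n::finite^'n \<Rightarrow> complex^('m::finite \<times> 'n)^('m \<times> 'n)" where
  "id_kron A = (\<chi> ij lm. if fst ij = fst lm then A $ snd ij $ snd lm else 0)"

definition right_commutant :: "complex^('m::finite \<times> 'n::finite)^('m \<times> 'n) \<Rightarrow> (complex^'n^'n) set" where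
  "right_commutant \<Sigma> = {A. (id_kron A :: complex^('m \<times> 'n)^('m \<times> 'n)) ** \<Sigma>
                            = \<Sigma> ** id_kron A}"

definition vecm :: "complex^'n::finite^'m::finite \<Rightarrow> complex^('m \<times> 'n)" where
  "vecm H = (\<chi> ij. H $ fst ij $ snd ij)"

text \<open>Standard circularly symmetric complex Gaussian vector on C^K:
  density pi^(-K) exp(-|z|^2) w.r.t. Lebesgue measure (i.i.d. entries,
  real and imaginary parts independent N(0,1/2), so E(z z^H) = 1).\<close>
definition std_cgauss :: "(complex^'k::finite) measure" where
  "std_cgauss = density lborel (\<lambda>z. ennreal (exp (- ((norm z)\<^sup>2)) / pi ^ card (UNIV :: 'k set)))"

text \<open>H ~ N(0,Sigma): vec(H) has the law of A z with z standard circular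
  complex Gaussian and A A^H = Sigma (zero mean, circular, covariance Sigma).\<close>
definition has_cgauss_law ::
  "'a measure \<Rightarrow> ('a \<Rightarrow> complex^'n::finite^'m::finite) \<Rightarrow> complex^('m \<times> 'n)^('m \<times> 'n) \<Rightarrow> bool" where
  "has_cgauss_law Pr H \<Sigma> \<longleftrightarrow>
     H \<in> Pr \<rightarrow>\<^sub>M borel \<and>
     (\<exists>A. A ** cadj A = \<Sigma> \<and>
        distr Pr borel (\<lambda>\<omega>. vecm (H \<omega>)) = distr (std_cgauss :: (complex^('m \<times> 'n)) measure) borel (\<lambda>z. A *v z))"

definition capC ::
  "'a measure \<Rightarrow> ('a \<Rightarrow> complex^'n::finite^'m::finite) \<Rightarrow> real \<Rightarrow> complex^'n^'n \<Rightarrow> real" where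
  "capC Pr H \<sigma>2 Q = (\<integral>\<omega>. ln (Re (det (mat 1 + mat (complex_of_real (inverse \<sigma>2))
                         ** (H \<omega> ** Q ** cadj (H \<omega>))))) \<partial>Pr)"

definition feasible_cov :: "real \<Rightarrow> complex^'n::finite^'n \<Rightarrow> bool" where
  "feasible_cov p Q \<longleftrightarrow> psd Q \<and> Re (trace Q) \<le> p"

definition capacity_achieving ::
  "'a measure \<Rightarrow> ('a \<Rightarrow> complex^'n::finite^'m::finite) \<Rightarrow> real \<Rightarrow> real \<Rightarrow> complex^'n^'n \<Rightarrow> bool" where
  "capacity_achieving Pr H \<sigma>2 p Q \<longleftrightarrow> feasible_cov p Q \<and>
     (\<forall>Q'. feasible_cov p Q' \<longrightarrow> capC Pr H \<sigma>2 Q' \<le> capC Pr H \<sigma>2 Q)"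

end

(*
  Each P = P_j gives a reflection T = 1 - 2 P, and 1 (x) T^t is a unitary commuting with Sigma, so
  H T has the same law as H and C(T Q T) = C(Q). By concavity of log det, averaging Q and T Q T does
  not decrease C, and the average commutes with P. Starting from any maximizer (which exists since C
  is continuous on the compact feasible set), the averages over P_1, ..., P_c commute with all P_j.

  Concavity of log det is obtained without a spectral theorem: for B > 0 and A >= 0 the polynomial
  t |-> det (A + t B) splits over the complex numbers and all its roots are real and nonpositive, so
  det A, det B and det (A + B) are compared factor by factor.

  The law of A z is invariant under a reflection S commuting with A A^H because then
  S A = A T for some real-linear isometry T, and the standard Gaussian is invariant under isometries.
*)
theory Submission
  imports Defs "HOL-Computational_Algebra.Fundamental_Theorem_Algebra"
begin

section \<open>Adjoints and positive (semi)definite matrices\<close>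

lemma mat_matrix_mult_component: "(mat k ** A) $ i $ j = k * A $ i $ j"
  for A :: "'a::semiring_1^'n::finite^'m::finite"
  by (simp add: matrix_matrix_mult_def mat_def if_distrib[of "\<lambda>x. x * _"] cong: if_cong)

lemma cadj_component [simp]: "cadj A $ i $ j = cnj (A $ j $ i)"
  by (simp add: cadj_def)

lemma cadj_cadj [simp]: "cadj (cadj A) = A"
  by (simp add: vec_eq_iff)

lemma cadj_add: "cadj (A + B) = cadj A + cadj B"
  by (simp add: vec_eq_iff)

lemma cadj_diff: "cadj (A - B) = cadj A - cadj B"
  by (simp add: vec_eq_iff)

lemma cadj_zero [simp]: "cadj 0 = 0"
  by (simp add: vec_eq_iff)

lemma cadj_scaleR: "cadj (r *\<^sub>R A) = r *\<^sub>R cadj A"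
  by (simp add: vec_eq_iff)

lemma cadj_mat [simp]: "cadj (mat k) = mat (cnj k)"
  by (simp add: vec_eq_iff mat_def)

lemma cadj_mult: "cadj (A ** B) = cadj B ** cadj A"
  by (simp add: vec_eq_iff matrix_matrix_mult_def mult.commute)

text \<open>The inner product of \<open>complex^'n\<close> as a real Euclidean space is the real
  part of the Hermitian form, so positivity can be handled with real inner products
  throughout.\<close>

lemma Re_qform: "Re (qform A x) = x \<bullet> (A *v x)"
  by (simp add: qform_def inner_vec_def inner_complex_def)

lemma sum_cnj_matrix_vector_cadj:
  "(\<Sum>i\<in>UNIV. cnj ((A *v x) $ i) * y $ i) = (\<Sum>i\<in>UNIV. cnj (x $ i) * (cadj A *v y) $ i)"
  by (simp add: matrix_vector_mult_def sum_distrib_left sum_distrib_right mult_ac)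
     (rule sum.swap)

lemma inner_matrix_vector_cadj: "(A *v x) \<bullet> y = x \<bullet> (cadj A *v y)"
proof -
  have inner_eq: "x \<bullet> y = Re (\<Sum>i\<in>UNIV. cnj (x $ i) * y $ i)" for x y :: "complex^'k"
    by (simp add: inner_vec_def inner_complex_def)
  show ?thesis by (simp only: inner_eq sum_cnj_matrix_vector_cadj)
qed

lemma psd_iff: "psd A \<longleftrightarrow> cadj A = A \<and> (\<forall>x. 0 \<le> x \<bullet> (A *v x))"
  by (simp add: psd_def Re_qform)

definition pd :: "complex^'n::finite^'n \<Rightarrow> bool" where
  "pd A \<longleftrightarrow> cadj A = A \<and> (\<forall>x. x \<noteq> 0 \<longrightarrow> 0 < x \<bullet> (A *v x))"

lemma pd_imp_psd: "pd A \<Longrightarrow> psd A"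
  unfolding pd_def psd_iff by (metis inner_zero_left less_eq_real_def)

lemma pd_mat_1: "pd (mat 1)"
  by (simp add: pd_def)

lemma psd_add: "psd A \<Longrightarrow> psd B \<Longrightarrow> psd (A + B)"
  by (simp add: psd_iff cadj_add matrix_vector_mult_add_rdistrib inner_add_right)

lemma pd_add_psd: "pd A \<Longrightarrow> psd B \<Longrightarrow> pd (A + B)"
  by (simp add: psd_iff pd_def cadj_add matrix_vector_mult_add_rdistrib inner_add_right add_pos_nonneg)

lemma scaleR_matrix_vector_mult: "(r *\<^sub>R A) *v x = r *\<^sub>R (A *v x)" for A :: "complex^'n::finite^'m::finite"
  by (simp add: vec_eq_iff matrix_vector_mult_def scaleR_sum_right)

lemma psd_scaleR: "psd A \<Longrightarrow> 0 \<le> r \<Longrightarrow> psd (r *\<^sub>R A)"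
  by (simp add: psd_iff cadj_scaleR scaleR_matrix_vector_mult)

lemma psd_congruence: "psd Q \<Longrightarrow> psd (H ** Q ** cadj H)" for H :: "complex^'n::finite^'m::finite"
proof -
  assume "psd Q"
  have "x \<bullet> ((H ** Q ** cadj H) *v x) = (cadj H *v x) \<bullet> (Q *v (cadj H *v x))" for x
    by (metis inner_matrix_vector_cadj matrix_vector_mul_assoc cadj_cadj)
  with \<open>psd Q\<close> show ?thesis
    by (simp add: psd_iff cadj_mult matrix_mul_assoc)
qed

lemma qform_hermitian_real:
  assumes "cadj A = A" shows "qform A x = of_real (x \<bullet> (A *v x))"
proof -
  have "cnj (A $ i $ j) = A $ j $ i" for i j
    using assms by (metis cadj_component)
  then have "cnj (qform A x) = qform A x"
    by (simp add: qform_def matrix_vector_mult_def sum_distrib_left mult_ac)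
       (rule sum.swap)
  then show ?thesis
    by (metis Re_qform Reals_cnj_iff of_real_Re)
qed

section \<open>Determinants of pencils A + t B and concavity of log det\<close>

lemma coeff_prod_linear:
  fixes a b :: "'i \<Rightarrow> 'a::comm_ring_1"
  assumes "finite S"
  shows "degree (\<Prod>i\<in>S. [:a i, b i:]) \<le> card S \<and> coeff (\<Prod>i\<in>S. [:a i, b i:]) (card S) = (\<Prod>i\<in>S. b i)"
  using assms
proof (induction S)
  case (insert x S)
  let ?p = "\<Prod>i\<in>S. [:a i, b i:]"
  have "degree ([:a x, b x:] * ?p) \<le> Suc (card S)"
    using degree_mult_le[of "[:a x, b x:]" ?p] insert.IH
    by (simp add: degree_pCons_eq_if split: if_splits)
  moreover have "coeff ([:a x, b x:] * ?p) (Suc (card S)) = b x * (\<Prod>i\<in>S. b i)"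
    using insert.IH by (simp add: coeff_eq_0 mult_pCons_left)
  ultimately show ?case using insert.hyps by simp
qed simp

text \<open>Expand the determinant of a matrix of linear polynomials. Every permutation contributes
  a product of n linear factors, whose coefficient of t^n is the corresponding product of entries of
  \<open>B\<close>.\<close>

lemma det_pencil_poly:
  fixes A B :: "complex^'n::finite^'n"
  obtains q where "\<And>t. poly q t = det (A + mat t ** B)" "degree q \<le> CARD('n)" "coeff q CARD('n) = det B"
proof
  let ?q = "det (\<chi> i j. [:A $ i $ j, B $ i $ j:]) :: complex poly"
  have sgn: "(of_int k :: complex poly) * p = smult (of_int k) p" for k p
    by (simp add: of_int_poly)
  show "poly ?q t = det (A + mat t ** B)" for t
    by (simp add: det_def poly_sum poly_prod mat_matrix_mult_component sgn)
  have *: "degree (\<Prod>i\<in>UNIV. [:A $ i $ p i, B $ i $ p i:]) \<le> CARD('n)"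
    "coeff (\<Prod>i\<in>UNIV. [:A $ i $ p i, B $ i $ p i:]) CARD('n) = (\<Prod>i\<in>UNIV. B $ i $ p i)" for p
    using coeff_prod_linear[of UNIV "\<lambda>i. A $ i $ p i" "\<lambda>i. B $ i $ p i"] by auto
  show "degree ?q \<le> CARD('n)"
    unfolding det_def sgn
    by (rule degree_sum_le) (auto intro!: order.trans[OF degree_smult_le] * simp: finite_permutations)
  show "coeff ?q CARD('n) = det B"
    unfolding det_def sgn by (simp add: coeff_sum *)
qed

text \<open>A kernel vector x gives 0 = x^H A x + t x^H B x. Both forms are real because the
  matrices are Hermitian, so t is minus a quotient of a nonnegative by a positive number.\<close>

lemma singular_pencil_root:
  fixes A B :: "complex^'n::finite^'n"
  assumes A: "psd A" and B: "pd B" and det: "det (A + mat t ** B) = 0"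
  shows "\<exists>r\<ge>0. t = - of_real r"
proof -
  obtain x where x: "x \<noteq> 0" "(A + mat t ** B) *v x = 0"
    using det invertible_det_nz[of "A + mat t ** B"] matrix_left_invertible_ker[of "A + mat t ** B"]
      invertible_left_inverse[of "A + mat t ** B"] by auto
  have "0 = qform (A + mat t ** B) x"
    by (simp add: qform_def x)
  also have "\<dots> = qform A x + t * qform B x"
    by (simp add: qform_def matrix_vector_mult_def mat_matrix_mult_component sum_distrib_left
        distrib_left distrib_right sum.distrib mult_ac)
  also have "\<dots> = of_real (x \<bullet> (A *v x)) + t * of_real (x \<bullet> (B *v x))"
    using A B by (simp add: qform_hermitian_real psd_iff pd_def)
  finally have "t * of_real (x \<bullet> (B *v x)) = - of_real (x \<bullet> (A *v x))"
    by (metis add.commute add_eq_0_iff)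
  moreover have "0 < x \<bullet> (B *v x)" "0 \<le> x \<bullet> (A *v x)"
    using A B x by (auto simp: psd_iff pd_def)
  ultimately have "t = - of_real ((x \<bullet> (A *v x)) / (x \<bullet> (B *v x)))"
    by (simp add: field_simps)
  with \<open>0 < x \<bullet> (B *v x)\<close> \<open>0 \<le> x \<bullet> (A *v x)\<close> show ?thesis
    by (intro exI[of _ "(x \<bullet> (A *v x)) / (x \<bullet> (B *v x))"]) auto
qed

lemma det_pd_nonzero:
  assumes "pd B" shows "det B \<noteq> (0::complex)"
proof
  assume "det B = 0"
  then obtain x where x: "x \<noteq> 0" "B *v x = 0"
    using invertible_det_nz[of B] matrix_left_invertible_ker[of B] invertible_left_inverse[of B]
    by auto
  with assms show False unfolding pd_def by (metis inner_zero_right less_irrefl)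
qed

text \<open>The degree is exactly n because the top coefficient \<open>det B\<close> is nonzero. The
  fundamental theorem of algebra then splits the polynomial, and each root makes the pencil
  singular, hence is some - r with r \<ge> 0.\<close>

lemma det_pencil_factorization:
  fixes A B :: "complex^'n::finite^'n"
  assumes "psd A" "pd B"
  obtains r where "\<And>i. i < CARD('n) \<Longrightarrow> 0 \<le> r i"
    "\<And>t. det (A + mat t ** B) = det B * (\<Prod>i<CARD('n). t + of_real (r i))"
proof -
  obtain q where q: "\<And>t. poly q t = det (A + mat t ** B)" "degree q \<le> CARD('n)" "coeff q CARD('n) = det B"
    using det_pencil_poly[of A B] by blast
  have deg: "degree q = CARD('n)"
    using q(2,3) det_pd_nonzero[OF assms(2)] le_degree[of q "CARD('n)"] by simp
  obtain root where root: "smult (lead_coeff q) (\<Prod>i<degree q. [:-root i, 1:]) = q"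
    using complex_poly_decompose' by blast
  have eval: "poly q t = det B * (\<Prod>i<CARD('n). t - root i)" for t
    by (subst root[symmetric]) (simp add: poly_prod deg q(3))
  have "\<exists>r\<ge>0. root i = - of_real r" if "i < CARD('n)" for i
    using that eval[of "root i"] q(1)[of "root i"]
    by (intro singular_pencil_root[OF assms]) (metis finite_lessThan lessThan_iff mult_zero_right prod_zero_iff right_minus_eq)
  then obtain r where r: "\<And>i. i < CARD('n) \<Longrightarrow> 0 \<le> r i \<and> root i = - of_real (r i)"
    by metis
  show thesis
  proof
    show "det (A + mat t ** B) = det B * (\<Prod>i<CARD('n). t + of_real (r i))" for t
      unfolding q(1)[symmetric] eval using r by (auto intro!: prod.cong)
  qed (use r in auto)
qed

text \<open>Apply the factorization to the pencil 1 + t B at t = 0: it reads 1 = det B * R with R a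
  product of nonnegative reals, so det B = 1 / R.\<close>

lemma det_pd_pos:
  assumes "pd B" shows "0 < Re (det B)" "Im (det B) = 0"
proof -
  obtain r :: "nat \<Rightarrow> real" where r: "\<And>i. i < CARD('a) \<Longrightarrow> 0 \<le> r i"
    "\<And>t. det (mat 1 + mat t ** B) = det B * (\<Prod>i<CARD('a). t + of_real (r i))"
    using det_pencil_factorization[OF pd_imp_psd[OF pd_mat_1] assms] by blast
  define R where "R = (\<Prod>i<CARD('a). r i)"
  have "mat 0 ** B = 0"
    by (simp add: vec_eq_iff mat_matrix_mult_component)
  then have "1 = det B * of_real R"
    using r(2)[of 0] by (simp add: R_def)
  moreover have "0 \<le> R" unfolding R_def by (rule prod_nonneg) (use r in auto)
  ultimately have "0 < R" "det B = of_real (1 / R)"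
    by (auto simp: divide_simps less_le)
  then show "0 < Re (det B)" "Im (det B) = 0" by auto
qed

text \<open>At t = 1 the pencil A + t 1 has determinant \<Prod> (1 + r_i) with r_i \<ge> 0. The
  bound makes the later logarithms nonnegative and keeps their arguments away from 0.\<close>

lemma det_one_plus_psd_ge_1:
  assumes "psd A" shows "1 \<le> Re (det (mat 1 + A))"
proof -
  obtain r :: "nat \<Rightarrow> real" where r: "\<And>i. i < CARD('a) \<Longrightarrow> 0 \<le> r i"
    "\<And>t. det (A + mat t ** mat 1) = det (mat 1 :: complex^'a^'a) * (\<Prod>i<CARD('a). t + of_real (r i))"
    using det_pencil_factorization[OF assms pd_mat_1] by blast
  have "det (mat 1 + A) = of_real (\<Prod>i<CARD('a). 1 + r i)"
    using r(2)[of 1] by (simp add: add.commute)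
  moreover have "1 \<le> (\<Prod>i<CARD('a). 1 + r i)"
    by (rule prod_ge_1) (use r in auto)
  ultimately show ?thesis by (metis Re_complex_of_real)
qed

lemma det_scaleR: "det (k *\<^sub>R A) = of_real (k ^ CARD('n)) * det A" for A :: "complex^'n::finite^'n"
proof -
  have "(k *\<^sub>R A) $ i $ j = of_real k * A $ i $ j" for i j
    by (simp only: vector_scaleR_component) (simp only: scaleR_conv_of_real)
  then show ?thesis
    by (simp add: det_def prod.distrib sum_distrib_left mult_ac del: vector_scaleR_component)
qed

text \<open>With b = det B, the factorization at t = 0 and t = 1 gives det A = b \<Prod> r_i and det
  ((A + B) / 2) = b \<Prod> (1 + r_i) / 2. The claim is the AM-GM inequality for r_i and 1, factor
  by factor. Only the midpoint case is required, since only averages of two matrices are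
  formed.\<close>

lemma ln_det_midpoint_concave:
  fixes A B :: "complex^'n::finite^'n"
  assumes A: "pd A" and B: "pd B"
  shows "(ln (Re (det A)) + ln (Re (det B))) / 2 \<le> ln (Re (det ((1/2) *\<^sub>R (A + B))))"
proof -
  obtain r :: "nat \<Rightarrow> real" where r: "\<And>i. i < CARD('n) \<Longrightarrow> 0 \<le> r i"
    "\<And>t. det (A + mat t ** B) = det B * (\<Prod>i<CARD('n). t + of_real (r i))"
    using det_pencil_factorization[OF pd_imp_psd[OF A] B] by blast
  define b where "b = Re (det B)"
  define m where "m = (\<Prod>i<CARD('n). (1 + r i) / 2)"
  have b: "det B = of_real b" "0 < b" using det_pd_pos[OF B] by (auto simp: b_def complex_eq_iff)
  have "mat 0 ** B = 0"
    by (simp add: vec_eq_iff mat_matrix_mult_component)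
  then have detA: "Re (det A) = b * (\<Prod>i<CARD('n). r i)"
    using r(2)[of 0] b by (simp flip: of_real_prod)
  define P where "P = (\<Prod>i<CARD('n). 1 + r i)"
  have "det (A + B) = of_real (b * P)"
    using r(2)[of 1] b by (simp add: P_def)
  moreover have "b * m = (1/2) ^ CARD('n) * (b * P)"
    by (simp add: m_def P_def prod_dividef power_one_over)
  ultimately have mid: "Re (det ((1/2) *\<^sub>R (A + B))) = b * m"
    by (simp only: det_scaleR flip: of_real_mult) simp
  \<comment> \<open>Squared AM-GM for \<open>r i\<close> and 1; the difference of the two sides is
    (1 - r_i)^2 / 4.\<close>
  have "r i \<le> ((1 + r i) / 2)\<^sup>2" for i
    using zero_le_power2[of "1 - r i"] by (simp add: power2_eq_square field_simps)
  then have "(\<Prod>i<CARD('n). r i) \<le> (\<Prod>i<CARD('n). ((1 + r i) / 2)\<^sup>2)"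
    by (intro prod_mono) (use r in auto)
  then have "(\<Prod>i<CARD('n). r i) \<le> m\<^sup>2"
    by (simp add: m_def prod_power_distrib)
  moreover have "0 < m" unfolding m_def by (rule prod_pos) (use r(1) in \<open>auto simp: add_pos_nonneg\<close>)
  ultimately have le: "Re (det A) * b \<le> (b * m)\<^sup>2"
    using b by (simp add: detA power2_eq_square mult_ac)
  have "ln (Re (det A)) + ln b = ln (Re (det A) * b)"
    using det_pd_pos(1)[OF A] b by (simp add: ln_mult)
  also have "\<dots> \<le> ln ((b * m)\<^sup>2)"
    using le det_pd_pos(1)[OF A] b \<open>0 < m\<close> by (subst ln_le_cancel_iff) auto
  also have "\<dots> = 2 * ln (b * m)"
    using b \<open>0 < m\<close> by (subst ln_realpow) auto
  finally show ?thesis by (simp add: mid b_def)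
qed

section \<open>Isometry invariance of Lebesgue measure and of the standard Gaussian\<close>

lemma borel_measurable_linear:
  fixes T :: "'a::euclidean_space \<Rightarrow> 'b::euclidean_space"
  assumes "linear T" shows "T \<in> borel \<rightarrow>\<^sub>M borel"
  using assms by (intro borel_measurable_continuous_onI linear_continuous_on)
    (simp add: linear_conv_bounded_linear)

lemma nn_integral_lborel_shift:
  fixes f :: "'a::euclidean_space \<Rightarrow> ennreal"
  assumes "f \<in> borel \<rightarrow>\<^sub>M borel"
  shows "(\<integral>\<^sup>+x. f (c + x) \<partial>lborel) = (\<integral>\<^sup>+x. f x \<partial>lborel)"
proof -
  have "(\<integral>\<^sup>+x. f x \<partial>lborel) = (\<integral>\<^sup>+x. f x \<partial>distr lborel borel ((+) c))"
    by (simp add: lborel_distr_plus)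
  also have "\<dots> = (\<integral>\<^sup>+x. f (c + x) \<partial>lborel)"
    using assms by (subst nn_integral_distr) auto
  finally show ?thesis by simp
qed

text \<open>Both sides are translation invariant integrals of \<^term>\<open>f\<close>; multiplying by the volume of the unit ball
  and using Fubini compares them, as in the uniqueness proof for Haar measure. The library has
  this change of variables only for \<^typ>\<open>real^'n\<close>.\<close>
lemma nn_integral_lborel_isometry:
  fixes T :: "'a::euclidean_space \<Rightarrow> 'a"
  assumes T: "linear T" "\<And>x. norm (T x) = norm x" and f [measurable]: "f \<in> borel \<rightarrow>\<^sub>M borel"
  shows "(\<integral>\<^sup>+x. f (T x) \<partial>lborel) = (\<integral>\<^sup>+x. f x \<partial>lborel)"
proof -
  interpret T: linear T by fact
  have [measurable]: "T \<in> borel \<rightarrow>\<^sub>M borel"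
    using T(1) by (rule borel_measurable_linear)
  have "inj T"
    unfolding T.inj_iff_eq_0 using T(2) by (metis norm_eq_zero)
  then have surj: "surj T"
    using T(1) linear_injective_imp_surjective by blast
  \<comment> \<open>What matters about \<open>g\<close>: it is unchanged by \<open>T\<close> and by
    x \<mapsto> -x, and its integral is neither 0 nor infinite, so that it can be cancelled at the
    end.\<close>
  define g :: "'a \<Rightarrow> ennreal" where "g = indicator (cball 0 1)"
  have [measurable]: "g \<in> borel \<rightarrow>\<^sub>M borel"
    unfolding g_def by (intro borel_measurable_indicator) simp
  have g_T: "g (T x) = g x" and g_minus: "g (- x) = g x" for x
    by (auto simp: g_def T(2) split: split_indicator)
  define G where "G = (\<integral>\<^sup>+x. g x \<partial>lborel)"
  have "G = ennreal (unit_ball_vol DIM('a))"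
    by (simp add: G_def g_def emeasure_cball)
  then have G: "G \<noteq> 0" "G \<noteq> \<top>"
    by (simp_all add: ennreal_eq_0_iff not_le)
  have "(\<integral>\<^sup>+x. f x \<partial>lborel) * G = (\<integral>\<^sup>+y. (\<integral>\<^sup>+x. f x \<partial>lborel) * g y \<partial>lborel)"
    by (simp add: G_def nn_integral_cmult)
  also have "\<dots> = (\<integral>\<^sup>+y. (\<integral>\<^sup>+x. f (T y + x) * g y \<partial>lborel) \<partial>lborel)"
    by (simp add: nn_integral_multc nn_integral_lborel_shift)
  also have "\<dots> = (\<integral>\<^sup>+x. (\<integral>\<^sup>+y. f (T y + x) * g y \<partial>lborel) \<partial>lborel)"
    by (rule lborel_pair.Fubini'[of "\<lambda>x y. f (T y + x) * g y"]) measurable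
  also have "\<dots> = (\<integral>\<^sup>+x. (\<integral>\<^sup>+y. f (T y) * g (T y - x) \<partial>lborel) \<partial>lborel)"
  proof (rule nn_integral_cong)
    fix x :: 'a
    \<comment> \<open>Translating y by \<open>d\<close> translates \<open>T y\<close> by
      \<open>x\<close>. This removes \<open>x\<close> from the argument of \<open>f\<close> and
      moves it into \<open>g\<close>.\<close>
    obtain d where d: "x = T d" using surj by (metis surjD)
    have "(\<integral>\<^sup>+y. f (T y) * g (T y - x) \<partial>lborel) = (\<integral>\<^sup>+y. f (T (d + y)) * g (T (d + y) - x) \<partial>lborel)"
      by (rule nn_integral_lborel_shift[symmetric]) measurable
    also have "\<dots> = (\<integral>\<^sup>+y. f (T y + x) * g y \<partial>lborel)"
      by (simp add: d T.add g_T add.commute)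
    finally show "(\<integral>\<^sup>+y. f (T y + x) * g y \<partial>lborel) = (\<integral>\<^sup>+y. f (T y) * g (T y - x) \<partial>lborel)" ..
  qed
  also have "\<dots> = (\<integral>\<^sup>+y. (\<integral>\<^sup>+x. f (T y) * g (T y - x) \<partial>lborel) \<partial>lborel)"
    by (rule lborel_pair.Fubini'[of "\<lambda>y x. f (T y) * g (T y - x)"]) measurable
  also have "\<dots> = (\<integral>\<^sup>+y. f (T y) * G \<partial>lborel)"
  proof (rule nn_integral_cong)
    fix y :: 'a
    have "(\<integral>\<^sup>+x. f (T y) * g (T y - x) \<partial>lborel) = f (T y) * (\<integral>\<^sup>+x. g (- T y + x) \<partial>lborel)"
      by (subst nn_integral_cmult[symmetric]) (auto simp flip: g_minus[of "T y - _"])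
    then show "(\<integral>\<^sup>+x. f (T y) * g (T y - x) \<partial>lborel) = f (T y) * G"
      using nn_integral_lborel_shift[of g "- T y"] by (simp add: G_def)
  qed
  also have "\<dots> = (\<integral>\<^sup>+y. f (T y) \<partial>lborel) * G"
    by (rule nn_integral_multc) measurable
  finally show ?thesis
    using G by (simp add: ennreal_mult_cancel_left mult.commute[of _ G])
qed

lemma sets_std_cgauss [measurable_cong]: "sets std_cgauss = sets borel"
  by (simp add: std_cgauss_def)

lemma space_std_cgauss: "space std_cgauss = UNIV"
  by (simp add: std_cgauss_def)

text \<open>The density depends on the norm only, and Lebesgue measure is invariant. Real linearity
  of \<open>T\<close> is enough, which matters because the isometry constructed below is only known
  to be real-linear.\<close>

lemma std_cgauss_isometry:
  fixes T :: "complex^'k::finite \<Rightarrow> complex^'k"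
  assumes T: "linear T" "\<And>x. norm (T x) = norm x"
  shows "distr std_cgauss borel T = std_cgauss"
proof (rule measure_eqI)
  fix X assume "X \<in> sets (distr std_cgauss borel T)"
  then have [measurable]: "X \<in> sets borel" by simp
  have [measurable]: "T \<in> borel \<rightarrow>\<^sub>M borel"
    using T(1) by (rule borel_measurable_linear)
  let ?f = "\<lambda>z::complex^'k. ennreal (exp (- ((norm z)\<^sup>2)) / pi ^ CARD('k))"
  have "emeasure (distr std_cgauss borel T) X = (\<integral>\<^sup>+z. indicator X (T z) \<partial>std_cgauss)"
    by (subst nn_integral_indicator[symmetric])
       (auto simp: nn_integral_distr simp del: nn_integral_indicator)
  also have "\<dots> = (\<integral>\<^sup>+z. ?f (T z) * indicator X (T z) \<partial>lborel)"
    unfolding std_cgauss_def by (subst nn_integral_density) (auto simp: T(2))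
  also have "\<dots> = (\<integral>\<^sup>+z. ?f z * indicator X z \<partial>lborel)"
    by (rule nn_integral_lborel_isometry[OF T, of "\<lambda>z. ?f z * indicator X z"]) measurable
  also have "\<dots> = emeasure std_cgauss X"
    unfolding std_cgauss_def by (subst emeasure_density) auto
  finally show "emeasure (distr std_cgauss borel T) X = emeasure std_cgauss X" .
qed (simp add: sets_std_cgauss)

section \<open>Symmetries of the Gaussian law of A z\<close>

lemma orthogonal_projection_map:
  fixes V :: "'a::euclidean_space set"
  assumes "subspace V"
  obtains \<pi> where "linear \<pi>" "\<And>x. \<pi> x \<in> V" "\<And>x v. v \<in> V \<Longrightarrow> (x - \<pi> x) \<bullet> v = 0"
proof -
  obtain B where B: "B \<subseteq> V" "pairwise orthogonal B" "\<And>b. b \<in> B \<Longrightarrow> norm b = 1"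
    "independent B" "span B = V"
    using orthonormal_basis_subspace[OF assms] by metis
  have [simp]: "finite B" using B(4) independent_imp_finite by blast
  define \<pi> where "\<pi> x = (\<Sum>b\<in>B. (x \<bullet> b) *\<^sub>R b)" for x
  show thesis
  proof
    show "linear \<pi>"
      by (intro linearI) (simp_all add: \<pi>_def inner_left_distrib scaleR_left_distrib sum.distrib scaleR_sum_right)
    show "\<pi> x \<in> V" for x
      unfolding \<pi>_def using B(1) assms by (auto intro!: subspace_sum subspace_scale)
    have "\<pi> x \<bullet> b = x \<bullet> b" if "b \<in> B" for x b
    proof -
      have "\<pi> x \<bullet> b = (\<Sum>b'\<in>B. if b' = b then x \<bullet> b else 0)"
        unfolding \<pi>_def inner_sum_left
        by (rule sum.cong) (use B(2,3) that in \<open>auto simp: pairwise_def orthogonal_def norm_eq_1\<close>)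
      with that show ?thesis by simp
    qed
    then have "B \<subseteq> {v. (x - \<pi> x) \<bullet> v = 0}" for x
      by (auto simp: inner_diff_left)
    then have "span B \<subseteq> {v. (x - \<pi> x) \<bullet> v = 0}" for x
      by (rule span_minimal) (rule subspace_hyperplane)
    then show "(x - \<pi> x) \<bullet> v = 0" if "v \<in> V" for x v
      using B(5) that by auto
  qed
qed

text \<open>Since S is unitary and commutes with A A^H, |A^H S y|^2 = <y, A A^H y> = |A^H y|^2.
  Hence A^H y \<mapsto> A^H S y is an isometry on the range of A^H, and A (A^H S y) = S A (A^H y) is
  the intertwining relation there.\<close>

lemma intertwining_isometry:
  fixes A S :: "complex^'k::finite^'k"
  assumes S: "cadj S ** S = mat 1" "S ** (A ** cadj A) = (A ** cadj A) ** S"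
  obtains T where "linear T" "\<And>x. norm (T x) = norm x" "\<And>x. A *v T x = S *v (A *v x)"
proof -
  let ?f = "\<lambda>x. cadj A *v x"
  have lin: "linear ?f" "linear (\<lambda>x. cadj A *v (S *v x))"
    using matrix_vector_mul_bounded_linear bounded_linear.linear
    by (auto simp: matrix_vector_mul_assoc)
  obtain \<pi> where \<pi>: "linear \<pi>" "\<And>x. \<pi> x \<in> range ?f" "\<And>x v. v \<in> range ?f \<Longrightarrow> (x - \<pi> x) \<bullet> v = 0"
    using orthogonal_projection_map[of "range ?f"] lin(1) linear_subspace_image[OF _ subspace_UNIV]
    by metis
  \<comment> \<open>A linear choice of preimages under A^H makes \<open>T\<close> a linear function
    at once, without checking that its value is independent of the preimage.\<close>
  obtain h where h: "linear h" "\<And>v. v \<in> range ?f \<Longrightarrow> ?f (h v) = v"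
    using linear_exists_right_inverse_on[OF lin(1) subspace_UNIV] by metis
  \<comment> \<open>\<^term>\<open>T\<close> maps \<^term>\<open>cadj A *v y\<close> to \<^term>\<open>cadj A *v (S *v y)\<close> and fixes the orthogonal complement
    of the range of \<^term>\<open>cadj A\<close>, which is the kernel of \<^term>\<open>A\<close>.\<close>
  define T where "T x = cadj A *v (S *v (h (\<pi> x))) + (x - \<pi> x)" for x
  have orth: "(x - \<pi> x) \<bullet> (cadj A *v y) = 0" for x y
    by (rule \<pi>(3)) simp
  show thesis
  proof
    have "linear (\<lambda>x. h (\<pi> x))"
      using linear_compose[OF \<pi>(1) h(1)] by (simp add: o_def)
    then have "linear (\<lambda>x. cadj A *v (S *v (h (\<pi> x))))"
      using linear_compose[OF _ lin(2)] by (simp add: o_def)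
    then show "linear T"
      unfolding T_def by (intro linear_compose_add linear_compose_sub linear_id[unfolded id_def] \<pi>(1))
    have isom: "norm (cadj A *v (S *v y)) = norm (cadj A *v y)" for y
    proof -
      have e: "(cadj A *v w) \<bullet> (cadj A *v w) = w \<bullet> ((A ** cadj A) *v w)" for w
        by (subst inner_matrix_vector_cadj) (simp add: matrix_vector_mul_assoc)
      have "(cadj A *v (S *v y)) \<bullet> (cadj A *v (S *v y)) = (S *v y) \<bullet> (((A ** cadj A) ** S) *v y)"
        unfolding e by (simp only: matrix_vector_mul_assoc)
      also have "\<dots> = (S *v y) \<bullet> (S *v ((A ** cadj A) *v y))"
        by (simp add: S(2)[symmetric] matrix_vector_mul_assoc)
      also have "\<dots> = y \<bullet> ((cadj S ** S) *v ((A ** cadj A) *v y))"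
        by (simp only: inner_matrix_vector_cadj matrix_vector_mul_assoc matrix_mul_assoc)
      also have "\<dots> = (cadj A *v y) \<bullet> (cadj A *v y)"
        by (simp add: S(1) e)
      finally show ?thesis by (simp add: norm_eq_sqrt_inner)
    qed
    show "norm (T x) = norm x" for x
    proof -
      have "(norm (T x))\<^sup>2 = (norm (cadj A *v (S *v (h (\<pi> x)))))\<^sup>2 + (norm (x - \<pi> x))\<^sup>2"
        unfolding T_def by (rule norm_add_Pythagorean) (simp add: orthogonal_def inner_commute orth)
      also have "\<dots> = (norm (\<pi> x))\<^sup>2 + (norm (x - \<pi> x))\<^sup>2"
        by (simp add: isom h(2)[OF \<pi>(2)])
      also have "\<dots> = (norm (\<pi> x + (x - \<pi> x)))\<^sup>2"
        by (rule norm_add_Pythagorean[symmetric]) (metis orthogonal_def inner_commute \<pi>(2,3))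
      finally show ?thesis by simp
    qed
    show "A *v T x = S *v (A *v x)" for x
    proof -
      have "(A *v (x - \<pi> x)) \<bullet> y = 0" for y
        by (simp add: inner_matrix_vector_cadj orth)
      then have "A *v (x - \<pi> x) = 0" by (metis inner_eq_zero_iff)
      then have *: "A *v \<pi> x = A *v x"
        by (simp add: matrix_vector_mult_diff_distrib)
      have "A *v T x = ((A ** cadj A) ** S) *v h (\<pi> x)"
        using \<open>A *v (x - \<pi> x) = 0\<close>
        by (simp add: T_def matrix_vector_right_distrib matrix_vector_mul_assoc matrix_mul_assoc)
      also have "\<dots> = S *v (A *v (cadj A *v h (\<pi> x)))"
        by (simp add: S(2)[symmetric] matrix_vector_mul_assoc matrix_mul_assoc)
      finally show ?thesis by (simp add: h(2)[OF \<pi>(2)] *)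
    qed
  qed
qed

lemma measurable_matrix_vector_mult [measurable]:
  "(\<lambda>z. A *v z) \<in> borel \<rightarrow>\<^sub>M borel" for A :: "complex^'n::finite^'m::finite"
  by (rule borel_measurable_linear) (simp add: bounded_linear.linear)

lemma distr_cgauss_invariant:
  fixes A S :: "complex^'k::finite^'k"
  assumes "cadj S ** S = mat 1" "S ** (A ** cadj A) = (A ** cadj A) ** S"
  shows "distr (distr std_cgauss borel (\<lambda>z. A *v z)) borel (\<lambda>z. S *v z) = distr std_cgauss borel (\<lambda>z. A *v z)"
proof -
  obtain T where T: "linear T" "\<And>x. norm (T x) = norm x" "\<And>x. A *v T x = S *v (A *v x)"
    using intertwining_isometry[OF assms] by blast
  have [measurable]: "T \<in> borel \<rightarrow>\<^sub>M borel"
    using T(1) by (rule borel_measurable_linear)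
  have "distr std_cgauss borel (\<lambda>z. A *v z) = distr (distr std_cgauss borel T) borel (\<lambda>z. A *v z)"
    by (simp add: std_cgauss_isometry T)
  also have "\<dots> = distr std_cgauss borel (\<lambda>z. S *v (A *v z))"
    by (subst distr_distr) (auto simp: o_def T(3))
  also have "\<dots> = distr (distr std_cgauss borel (\<lambda>z. A *v z)) borel (\<lambda>z. S *v z)"
    by (subst distr_distr) (auto simp: o_def)
  finally show ?thesis ..
qed

section \<open>Second moment of the standard Gaussian\<close>

lemma integrable_norm_sq_std_cgauss:
  assumes "emeasure (std_cgauss :: (complex^'k::finite) measure) UNIV < \<infinity>"
  shows "integrable (std_cgauss :: (complex^'k) measure) (\<lambda>z. (norm z)\<^sup>2)"
proof (rule integrableI_nonneg)
  let ?f = "\<lambda>z::complex^'k. exp (- ((norm z)\<^sup>2)) / pi ^ CARD('k)"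
  let ?d = "DIM(complex^'k)"
  have le: "ennreal (?f z) * ennreal ((norm z)\<^sup>2) \<le> 2 * ennreal (?f ((1 / sqrt 2) *\<^sub>R z))" for z
  proof -
    let ?t = "(norm z)\<^sup>2"
    \<comment> \<open>Half of the exponential decay absorbs the factor |z|^2. What remains is the
      density at z / sqrt 2, so the second moment is bounded by a multiple of the total mass and no
      Gaussian integral has to be evaluated.\<close>
    have "?t \<le> 2 * exp (?t / 2)"
      using exp_ge_add_one_self[of "?t / 2"] by linarith
    then have "exp (- ?t) * ?t \<le> exp (- ?t) * (2 * exp (?t / 2))"
      by (intro mult_left_mono) auto
    also have "\<dots> = 2 * exp (- (?t / 2))"
      by (simp flip: exp_add)
    finally have "?f z * ?t \<le> 2 * ?f ((1 / sqrt 2) *\<^sub>R z)"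
      by (simp add: power_divide divide_right_mono)
    then have "ennreal (?f z * ?t) \<le> ennreal (2 * ?f ((1 / sqrt 2) *\<^sub>R z))"
      by (rule ennreal_leI)
    moreover have "ennreal (?f z * ?t) = ennreal (?f z) * ennreal ?t"
      by (rule ennreal_mult) auto
    moreover have "ennreal (2 * ?f ((1 / sqrt 2) *\<^sub>R z)) = ennreal 2 * ennreal (?f ((1 / sqrt 2) *\<^sub>R z))"
      by (rule ennreal_mult) auto
    ultimately show ?thesis by (simp only: ennreal_numeral)
  qed
  have "(\<integral>\<^sup>+z. ennreal ((norm z)\<^sup>2) \<partial>(std_cgauss :: (complex^'k) measure)) = (\<integral>\<^sup>+z. ennreal (?f z) * ennreal ((norm z)\<^sup>2) \<partial>lborel)"
    unfolding std_cgauss_def by (subst nn_integral_density) auto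
  also have "\<dots> \<le> (\<integral>\<^sup>+z. 2 * ennreal (?f ((1 / sqrt 2) *\<^sub>R z)) \<partial>lborel)"
    by (intro nn_integral_mono le)
  \<comment> \<open>Substitute sqrt 2 * z for z; the Jacobian is (sqrt 2)^d with d the real
    dimension.\<close>
  also have "\<dots> = (\<integral>\<^sup>+z. 2 * ennreal (?f ((1 / sqrt 2) *\<^sub>R z))
      \<partial>density (distr lborel borel (\<lambda>x. 0 + sqrt 2 *\<^sub>R x)) (\<lambda>_. \<bar>sqrt 2\<bar> ^ ?d))"
    by (subst lborel_affine[of "sqrt 2" 0]) auto
  also have "\<dots> = (\<integral>\<^sup>+z. ennreal (\<bar>sqrt 2\<bar> ^ ?d) * (2 * ennreal (?f z)) \<partial>lborel)"
    by (subst nn_integral_density) (auto simp: nn_integral_distr)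
  also have "\<dots> = ennreal (\<bar>sqrt 2\<bar> ^ ?d) * (2 * (\<integral>\<^sup>+z. ennreal (?f z) \<partial>lborel))"
    by (simp add: nn_integral_cmult)
  also have "(\<integral>\<^sup>+z. ennreal (?f z) \<partial>lborel) = emeasure (std_cgauss :: (complex^'k) measure) UNIV"
    unfolding std_cgauss_def by (subst emeasure_density) auto
  also have "ennreal (\<bar>sqrt 2\<bar> ^ ?d) * (2 * emeasure (std_cgauss :: (complex^'k) measure) UNIV) < \<infinity>"
    using assms by (simp add: ennreal_mult_less_top)
  finally show "(\<integral>\<^sup>+z. ennreal ((norm z)\<^sup>2) \<partial>(std_cgauss :: (complex^'k) measure)) < \<infinity>" .
qed auto

section \<open>The rate of a single channel realization\<close>

definition rate :: "real \<Rightarrow> complex^'n::finite^'n \<Rightarrow> complex^'n^'m::finite \<Rightarrow> real" where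
  "rate s Q H = ln (Re (det (mat 1 + s *\<^sub>R (H ** Q ** cadj H))))"

lemma matrix_add_rdistrib: "(A + B) ** C = A ** C + B ** C"
  by (simp add: vec_eq_iff matrix_matrix_mult_def distrib_right sum.distrib)

lemma matrix_scaleR_left: "(r *\<^sub>R A) ** B = r *\<^sub>R (A ** B)"
  for A :: "complex^'n::finite^'m::finite"
  by (simp add: vec_eq_iff matrix_matrix_mult_def scaleR_sum_right)

lemma matrix_scaleR_right: "A ** (r *\<^sub>R B) = r *\<^sub>R (A ** B)"
  for A :: "complex^'n::finite^'m::finite"
  by (simp add: vec_eq_iff matrix_matrix_mult_def scaleR_sum_right)

lemma mat_of_real_mult: "mat (complex_of_real s) ** A = s *\<^sub>R A" for A :: "complex^'n::finite^'m::finite"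
proof -
  have "(s *\<^sub>R A) $ i $ j = of_real s * A $ i $ j" for i j
    by (simp only: vector_scaleR_component) (simp only: scaleR_conv_of_real)
  then show ?thesis
    by (simp add: vec_eq_iff mat_matrix_mult_component del: vector_scaleR_component)
qed

text \<open>Real scaling by the inverse noise variance replaces the product with a scalar matrix; in
  this form the positivity and concavity lemmas apply.\<close>

lemma capC_eq_rate: "capC Pr H \<sigma>2 Q = (\<integral>\<omega>. rate (inverse \<sigma>2) Q (H \<omega>) \<partial>Pr)"
  by (simp add: capC_def rate_def mat_of_real_mult del: of_real_inverse)

lemma continuous_on_det:
  fixes f :: "'a::topological_space \<Rightarrow> complex^'n::finite^'n"
  assumes "continuous_on X f" shows "continuous_on X (\<lambda>x. det (f x))"
  unfolding det_def using assms by (intro continuous_intros)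

lemma continuous_on_matrix_mult:
  fixes f :: "'a::topological_space \<Rightarrow> complex^'n::finite^'m::finite" and g :: "'a \<Rightarrow> complex^'k::finite^'n"
  assumes "continuous_on X f" "continuous_on X g" shows "continuous_on X (\<lambda>x. f x ** g x)"
  unfolding matrix_matrix_mult_def using assms by (intro continuous_intros)

lemma continuous_on_cadj:
  fixes f :: "'a::topological_space \<Rightarrow> complex^'n::finite^'m::finite"
  assumes "continuous_on X f" shows "continuous_on X (\<lambda>x. cadj (f x))"
  unfolding cadj_def using assms by (intro continuous_intros)

lemma continuous_on_det_rate:
  fixes Q :: "'a::topological_space \<Rightarrow> complex^'n::finite^'n" and H :: "'a \<Rightarrow> complex^'n^'m::finite"
  assumes "continuous_on X Q" "continuous_on X H"
  shows "continuous_on X (\<lambda>x. Re (det (mat 1 + s *\<^sub>R (H x ** Q x ** cadj (H x)))))"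
  using assms
  by (intro continuous_intros continuous_on_det continuous_on_matrix_mult continuous_on_cadj)

lemma measurable_rate [measurable]: "rate s Q \<in> borel \<rightarrow>\<^sub>M borel"
proof -
  have "(\<lambda>H. Re (det (mat 1 + s *\<^sub>R (H ** Q ** cadj H)))) \<in> borel \<rightarrow>\<^sub>M borel"
    by (intro borel_measurable_continuous_onI continuous_on_det_rate continuous_on_id continuous_on_const)
  then show ?thesis unfolding rate_def[abs_def] by measurable
qed

lemma pd_rate_matrix: "psd Q \<Longrightarrow> 0 \<le> s \<Longrightarrow> pd (mat 1 + s *\<^sub>R (H ** Q ** cadj H))"
  by (intro pd_add_psd pd_mat_1 psd_scaleR psd_congruence)

lemma det_rate_ge_1: "psd Q \<Longrightarrow> 0 \<le> s \<Longrightarrow> 1 \<le> Re (det (mat 1 + s *\<^sub>R (H ** Q ** cadj H)))"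
  by (intro det_one_plus_psd_ge_1 psd_scaleR psd_congruence)

lemma rate_nonneg: "psd Q \<Longrightarrow> 0 \<le> s \<Longrightarrow> 0 \<le> rate s Q H"
  unfolding rate_def by (intro ln_ge_zero det_rate_ge_1)

text \<open>The matrix 1 + s H Q H^H is affine in Q, so midpoints go to midpoints and the concavity
  of log det carries over.\<close>

lemma rate_midpoint_concave:
  assumes "psd Q" "psd R" "0 \<le> s"
  shows "(rate s Q H + rate s R H) / 2 \<le> rate s ((1/2) *\<^sub>R (Q + R)) H"
proof -
  let ?M = "\<lambda>Q. mat 1 + s *\<^sub>R (H ** Q ** cadj H)"
  have "H ** ((1/2) *\<^sub>R (Q + R)) ** cadj H = (1/2) *\<^sub>R (H ** Q ** cadj H + H ** R ** cadj H)"
    by (simp only: matrix_scaleR_left matrix_scaleR_right matrix_add_ldistrib matrix_add_rdistrib)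
  then have "?M ((1/2) *\<^sub>R (Q + R)) = (1/2) *\<^sub>R (?M Q + ?M R)"
    by (simp add: scaleR_right_distrib vec_eq_iff mat_def)
  then show ?thesis
    unfolding rate_def using ln_det_midpoint_concave[OF pd_rate_matrix pd_rate_matrix] assms by metis
qed

section \<open>Bounds on the rate and compactness of the feasible set\<close>

lemma norm_det_le:
  fixes A :: "complex^'n::finite^'n"
  assumes "\<And>i j. norm (A $ i $ j) \<le> K"
  shows "norm (det A) \<le> fact CARD('n) * K ^ CARD('n)"
proof -
  have "norm (det A) \<le> (\<Sum>p | p permutes (UNIV :: 'n set). norm (of_int (sign p) * (\<Prod>i\<in>UNIV. A $ i $ p i)))"
    unfolding det_def by (rule norm_sum)
  also have "\<dots> \<le> (\<Sum>p | p permutes (UNIV :: 'n set). K ^ CARD('n))"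
  proof (rule sum_mono)
    fix p
    have "(\<Prod>i\<in>UNIV. norm (A $ i $ p i)) \<le> (\<Prod>i\<in>(UNIV :: 'n set). K)"
      by (intro prod_mono) (use assms in auto)
    then show "norm (of_int (sign p) * (\<Prod>i\<in>UNIV. A $ i $ p i)) \<le> K ^ CARD('n)"
      by (simp add: norm_mult prod_norm sign_def)
  qed
  also have "\<dots> = fact CARD('n) * K ^ CARD('n)"
    by (simp add: card_permutations)
  finally show ?thesis .
qed

lemma norm_congruence_component_le:
  fixes H :: "complex^'n::finite^'m::finite"
  assumes q: "\<And>k l. norm (Q $ k $ l) \<le> q"
  shows "norm ((H ** Q ** cadj H) $ i $ j) \<le> (real CARD('n))\<^sup>2 * q * (norm (vecm H))\<^sup>2"
proof -
  let ?v = "norm (vecm H)"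
  have H: "norm (H $ i $ k) \<le> ?v" for i k
    using Finite_Cartesian_Product.norm_nth_le[of "vecm H" "(i, k)"] by (simp add: vecm_def)
  have "0 \<le> q" using q norm_ge_zero order_trans by blast
  have "norm (\<Sum>k\<in>UNIV. H $ i $ k * Q $ k $ l) \<le> real CARD('n) * (?v * q)" for l
    by (rule sum_norm_bound) (auto simp: norm_mult intro!: mult_mono H q)
  then have "norm (\<Sum>l\<in>UNIV. (\<Sum>k\<in>UNIV. H $ i $ k * Q $ k $ l) * cnj (H $ j $ l))
      \<le> real CARD('n) * (real CARD('n) * (?v * q) * ?v)"
    using \<open>0 \<le> q\<close> by (intro sum_norm_bound) (auto simp: norm_mult intro!: mult_mono H)
  then show ?thesis
    by (simp add: matrix_matrix_mult_def power2_eq_square mult_ac)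
qed

text \<open>The entries of 1 + s H Q H^H are at most 1 + x with x quadratic in the norm of H. The
  Leibniz formula bounds the determinant by m! (1 + x)^m, and ln (1 + x) \<le> x. As
  \<open>Q\<close> enters only through \<open>q\<close>, the bound can serve as a common dominating
  function for many \<open>Q\<close>.\<close>

lemma rate_le:
  fixes H :: "complex^'n::finite^'m::finite"
  assumes "psd Q" "0 \<le> s" and q: "\<And>k l. norm (Q $ k $ l) \<le> q"
  shows "rate s Q H \<le> ln (fact CARD('m)) + real CARD('m) * (s * ((real CARD('n))\<^sup>2 * q)) * (norm (vecm H))\<^sup>2"
proof -
  define x where "x = s * ((real CARD('n))\<^sup>2 * q * (norm (vecm H))\<^sup>2)"
  have "0 \<le> q" using q norm_ge_zero order_trans by blast
  then have x: "0 \<le> x" using assms(2) by (simp add: x_def)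
  let ?M = "mat 1 + s *\<^sub>R (H ** Q ** cadj H)"
  have "norm (?M $ i $ j) \<le> 1 + x" for i j
  proof -
    have "norm (?M $ i $ j) \<le> norm ((mat 1 :: complex^'m^'m) $ i $ j) + s * norm ((H ** Q ** cadj H) $ i $ j)"
      using norm_triangle_ineq[of "(mat 1 :: complex^'m^'m) $ i $ j" "s *\<^sub>R ((H ** Q ** cadj H) $ i $ j)"] assms(2)
      by simp
    also have "\<dots> \<le> 1 + x"
      unfolding x_def using assms(2)
      by (intro add_mono mult_left_mono norm_congruence_component_le q) (auto simp: mat_def)
    finally show ?thesis .
  qed
  then have "norm (det ?M) \<le> fact CARD('m) * (1 + x) ^ CARD('m)"
    by (rule norm_det_le)
  then have "Re (det ?M) \<le> fact CARD('m) * (1 + x) ^ CARD('m)"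
    using complex_Re_le_cmod order_trans by blast
  then have "rate s Q H \<le> ln (fact CARD('m) * (1 + x) ^ CARD('m))"
    unfolding rate_def using det_rate_ge_1[OF assms(1,2), of H]
    by (intro ln_mono) linarith+
  also have "\<dots> = ln (fact CARD('m)) + real CARD('m) * ln (1 + x)"
    using x by (simp add: ln_mult ln_realpow)
  also have "\<dots> \<le> ln (fact CARD('m)) + real CARD('m) * x"
    using x by (intro add_left_mono mult_left_mono ln_add_one_self_le_self) auto
  finally show ?thesis by (simp add: x_def mult_ac)
qed

lemma inner_axis_matrix: "axis i a \<bullet> (Q *v axis j b) = Re (cnj a * (Q $ i $ j * b))"
  for Q :: "complex^'n::finite^'m::finite"
proof -
  have "(Q *v axis j b) $ i = Q $ i $ j * b"
    by (simp add: matrix_vector_mult_def axis_def if_distrib cong: if_cong)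
  then show ?thesis by (simp add: inner_axis' inner_complex_def)
qed

text \<open>Nonnegativity of the form at e_i + w e_j, for a suitable w with |w| = 1, yields 2 |Q_ij|
  \<le> Q_ii + Q_jj. Each diagonal entry is at most the trace because all of them are
  nonnegative.\<close>

lemma psd_component_le:
  assumes "psd Q" shows "norm (Q $ i $ j) \<le> Re (trace Q)"
proof -
  have Q: "cnj (Q $ i $ j) = Q $ j $ i" for i j
    using assms by (metis cadj_component psd_iff)
  have diag: "0 \<le> Re (Q $ i $ i)" for i
    using assms inner_axis_matrix[of i 1 Q i 1] by (simp add: psd_iff) metis
  then have tr: "Re (Q $ i $ i) \<le> Re (trace Q)" for i
    unfolding trace_def Re_sum by (intro member_le_sum) auto
  show ?thesis
  proof (cases "Q $ i $ j = 0")
    case True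
    then show ?thesis using diag[of i] tr[of i] by simp
  next
    case False
    \<comment> \<open>The phase that turns \<open>Q $ i $ j\<close> into a negative real
      number.\<close>
    define w where "w = - cnj (Q $ i $ j) / of_real (norm (Q $ i $ j))"
    have w: "cnj w * w = 1" "Q $ i $ j * w = - of_real (norm (Q $ i $ j))"
      using False complex_norm_square[of "Q $ i $ j"] by (auto simp: w_def field_simps power2_eq_square)
    have "cnj w * Q $ j $ i = cnj (Q $ i $ j * w)"
      by (simp add: Q mult.commute)
    also have "\<dots> = - of_real (norm (Q $ i $ j))"
      by (simp only: w(2)) simp
    finally have w': "cnj w * Q $ j $ i = - of_real (norm (Q $ i $ j))" .
    have e: "cnj w * (Q $ j $ j * w) = Q $ j $ j"
      using w(1) by (metis mult.left_commute mult.right_neutral)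
    have "(axis i 1 + axis j w) \<bullet> (Q *v (axis i 1 + axis j w)) =
        Re (Q $ i $ i) + Re (Q $ j $ j) - 2 * norm (Q $ i $ j)"
      by (simp only: matrix_vector_right_distrib inner_add_left inner_add_right inner_axis_matrix
          complex_cnj_one mult_1_left mult_1_right w(2) w' e) simp
    then have "2 * norm (Q $ i $ j) \<le> Re (Q $ i $ i) + Re (Q $ j $ j)"
      using assms unfolding psd_iff by (metis diff_ge_0_iff_ge)
    with tr[of i] tr[of j] show ?thesis by simp
  qed
qed

text \<open>Closed, being cut out by closed conditions, one for each test vector; bounded, because
  the trace dominates every entry.\<close>

lemma compact_feasible_cov: "compact {Q :: complex^'n::finite^'n. feasible_cov p Q}"
proof -
  have cont: "continuous_on UNIV (\<lambda>Q :: complex^'n^'n. Re (qform Q x))" for x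
    unfolding qform_def matrix_vector_mult_def by (intro continuous_intros)
  have "closed {Q :: complex^'n^'n. feasible_cov p Q}"
    unfolding feasible_cov_def psd_def trace_def
    by (intro closed_Collect_conj closed_Collect_all closed_Collect_eq closed_Collect_le cont
        continuous_on_cadj continuous_intros)
  moreover have "bounded {Q :: complex^'n^'n. feasible_cov p Q}"
  proof (rule boundedI)
    fix Q :: "complex^'n^'n" assume "Q \<in> {Q. feasible_cov p Q}"
    then have Q: "norm (Q $ i $ j) \<le> p" for i j
      using psd_component_le[of Q i j] by (simp add: feasible_cov_def)
    have "norm Q \<le> (\<Sum>i\<in>UNIV. norm (Q $ i))"
      unfolding norm_vec_def[of Q] by (intro L2_set_le_sum) auto
    also have "\<dots> \<le> (\<Sum>i\<in>UNIV. \<Sum>j\<in>UNIV. norm (Q $ i $ j))"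
      unfolding norm_vec_def[of "Q $ _"] by (intro sum_mono L2_set_le_sum) auto
    also have "\<dots> \<le> (\<Sum>i\<in>(UNIV::'n set). \<Sum>j\<in>(UNIV::'n set). p)"
      by (intro sum_mono Q)
    finally show "norm Q \<le> (\<Sum>i\<in>(UNIV::'n set). \<Sum>j\<in>(UNIV::'n set). p)" .
  qed
  ultimately show ?thesis by (simp add: compact_eq_bounded_closed)
qed

section \<open>Integrability, continuity of the capacity and existence of a maximizer\<close>

lemma measurable_vecm [measurable]: "vecm \<in> borel \<rightarrow>\<^sub>M (borel :: (complex^('m::finite \<times> 'n::finite)) measure)"
  unfolding vecm_def[abs_def] by (intro borel_measurable_continuous_onI continuous_intros)

lemma cgauss_law_second_moment:
  fixes H :: "'a \<Rightarrow> complex^'n::finite^'m::finite"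
  assumes "prob_space Pr" "has_cgauss_law Pr H \<Sigma>"
  shows "integrable Pr (\<lambda>\<omega>. (norm (vecm (H \<omega>)))\<^sup>2)"
proof -
  interpret prob_space Pr by fact
  obtain A where [measurable]: "H \<in> Pr \<rightarrow>\<^sub>M borel" and A:
    "distr Pr borel (\<lambda>\<omega>. vecm (H \<omega>)) = distr (std_cgauss :: (complex^('m \<times> 'n)) measure) borel (\<lambda>z. A *v z)"
    using assms(2) by (auto simp: has_cgauss_law_def)
  let ?g = "std_cgauss :: (complex^('m \<times> 'n)) measure"
  \<comment> \<open>The total mass of the standard Gaussian is read off from the law of
    \<open>H\<close>: the two image measures agree, and the law of \<open>H\<close> has mass
    1.\<close>
  have "emeasure ?g UNIV = emeasure (distr Pr borel (\<lambda>\<omega>. vecm (H \<omega>))) UNIV"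
    unfolding A by (subst emeasure_distr) (auto simp: space_std_cgauss)
  also have "\<dots> = 1"
    by (subst emeasure_distr) (auto simp: emeasure_space_1)
  finally have "integrable ?g (\<lambda>z. (norm z)\<^sup>2)"
    by (intro integrable_norm_sq_std_cgauss) simp
  moreover obtain K where K: "\<And>z. norm (A *v z) \<le> norm z * K"
    using bounded_linear.bounded[OF matrix_vector_mul_bounded_linear[of A]] by blast
  ultimately have int: "integrable ?g (\<lambda>z. (norm z)\<^sup>2 * K\<^sup>2)"
    by simp
  have le: "norm ((norm (A *v z))\<^sup>2) \<le> norm ((norm z)\<^sup>2 * K\<^sup>2)" for z
    using power_mono[OF K[of z] norm_ge_zero, of 2] by (simp add: power_mult_distrib)
  have "integrable ?g (\<lambda>z. (norm (A *v z))\<^sup>2)"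
    by (rule Bochner_Integration.integrable_bound[OF int _ AE_I2]) (measurable, rule le)
  then have "integrable (distr ?g borel (\<lambda>z. A *v z)) (\<lambda>v. (norm v)\<^sup>2)"
    by (subst integrable_distr_eq) auto
  then show ?thesis
    unfolding A[symmetric] by (subst (asm) integrable_distr_eq) auto
qed

lemma cgauss_law_invariant:
  fixes H :: "'a \<Rightarrow> complex^'n::finite^'m::finite" and \<phi> :: "complex^('m \<times> 'n) \<Rightarrow> real"
  assumes "has_cgauss_law Pr H \<Sigma>" "cadj S ** S = mat 1" "S ** \<Sigma> = \<Sigma> ** S"
    and [measurable]: "\<phi> \<in> borel \<rightarrow>\<^sub>M borel"
  shows "(\<integral>\<omega>. \<phi> (S *v vecm (H \<omega>)) \<partial>Pr) = (\<integral>\<omega>. \<phi> (vecm (H \<omega>)) \<partial>Pr)"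
proof -
  obtain A where [measurable]: "H \<in> Pr \<rightarrow>\<^sub>M borel" and A: "A ** cadj A = \<Sigma>"
    "distr Pr borel (\<lambda>\<omega>. vecm (H \<omega>)) = distr (std_cgauss :: (complex^('m \<times> 'n)) measure) borel (\<lambda>z. A *v z)"
    using assms(1) by (auto simp: has_cgauss_law_def)
  let ?\<mu> = "distr Pr borel (\<lambda>\<omega>. vecm (H \<omega>))"
  have "(\<integral>\<omega>. \<phi> (S *v vecm (H \<omega>)) \<partial>Pr) = (\<integral>v. \<phi> (S *v v) \<partial>?\<mu>)"
    by (subst integral_distr) auto
  also have "\<dots> = (\<integral>v. \<phi> v \<partial>distr ?\<mu> borel (\<lambda>v. S *v v))"
    by (subst (2) integral_distr) auto
  also have "distr ?\<mu> borel (\<lambda>v. S *v v) = ?\<mu>"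
    unfolding A(2) by (rule distr_cgauss_invariant) (use assms A in auto)
  also have "(\<integral>v. \<phi> v \<partial>?\<mu>) = (\<integral>\<omega>. \<phi> (vecm (H \<omega>)) \<partial>Pr)"
    by (subst integral_distr) auto
  finally show ?thesis .
qed

text \<open>By \<open>rate_le\<close> the rate is dominated by an affine function of the squared
  norm of the channel, which has finite mean.\<close>

lemma integrable_rate:
  fixes H :: "'a \<Rightarrow> complex^'n::finite^'m::finite"
  assumes "prob_space Pr" "has_cgauss_law Pr H \<Sigma>" "psd Q" "0 \<le> s"
  shows "integrable Pr (\<lambda>\<omega>. rate s Q (H \<omega>))"
proof -
  interpret prob_space Pr by fact
  have [measurable]: "H \<in> Pr \<rightarrow>\<^sub>M borel"
    using assms(2) by (simp add: has_cgauss_law_def)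
  define w where "w \<omega> = ln (fact CARD('m)) + real CARD('m) * (s * ((real CARD('n))\<^sup>2 * Re (trace Q))) * (norm (vecm (H \<omega>)))\<^sup>2" for \<omega>
  have "norm (rate s Q (H \<omega>)) \<le> norm (w \<omega>)" for \<omega>
    using rate_nonneg[OF assms(3,4), of "H \<omega>"] rate_le[OF assms(3,4) psd_component_le[OF assms(3)], of "H \<omega>"]
    by (simp add: w_def)
  moreover have "integrable Pr w"
    unfolding w_def using cgauss_law_second_moment[OF assms(1,2)] by simp
  ultimately show ?thesis
    by (intro Bochner_Integration.integrable_bound[OF \<open>integrable Pr w\<close>]) auto
qed

text \<open>Dominated convergence along sequences. The entries of a feasible matrix are at most
  \<open>p\<close>, so \<open>rate_le\<close> gives one dominating function for the whole
  sequence.\<close>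

lemma continuous_on_capC:
  fixes H :: "'a \<Rightarrow> complex^'n::finite^'m::finite"
  assumes "prob_space Pr" "has_cgauss_law Pr H \<Sigma>" "\<sigma>2 > 0"
  shows "continuous_on {Q. feasible_cov p Q} (capC Pr H \<sigma>2)"
  unfolding continuous_on_sequentially
proof (intro allI ballI impI, elim conjE)
  interpret prob_space Pr by fact
  have [measurable]: "H \<in> Pr \<rightarrow>\<^sub>M borel"
    using assms(2) by (simp add: has_cgauss_law_def)
  fix X :: "nat \<Rightarrow> complex^'n^'n" and Q
  assume Q: "Q \<in> {Q. feasible_cov p Q}" and X: "\<forall>k. X k \<in> {Q. feasible_cov p Q}" "X \<longlonglongrightarrow> Q"
  define s where "s = inverse \<sigma>2"
  have s: "0 \<le> s" using assms(3) by (simp add: s_def)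
  have psd: "psd Q" "\<And>k. psd (X k)" using Q X by (auto simp: feasible_cov_def)
  define w where "w \<omega> = ln (fact CARD('m)) + real CARD('m) * (s * ((real CARD('n))\<^sup>2 * p)) * (norm (vecm (H \<omega>)))\<^sup>2" for \<omega>
  have "integrable Pr w"
    unfolding w_def using cgauss_law_second_moment[OF assms(1,2)] by simp
  moreover have "(\<lambda>k. rate s (X k) (H \<omega>)) \<longlonglongrightarrow> rate s Q (H \<omega>)" for \<omega>
  proof -
    let ?d = "\<lambda>Q. Re (det (mat 1 + s *\<^sub>R (H \<omega> ** Q ** cadj (H \<omega>))))"
    have "continuous_on UNIV ?d"
      by (intro continuous_on_det_rate continuous_on_id continuous_on_const)
    then have "isCont ?d Q" by (simp add: continuous_on_eq_continuous_at)
    then have "(\<lambda>k. ?d (X k)) \<longlonglongrightarrow> ?d Q"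
      using X(2) by (rule isCont_tendsto_compose)
    then show ?thesis
      unfolding rate_def using det_rate_ge_1[OF psd(1) s, of "H \<omega>"] by (intro tendsto_ln) auto
  qed
  moreover have "norm (rate s (X k) (H \<omega>)) \<le> w \<omega>" for k \<omega>
  proof -
    have "norm (X k $ i $ j) \<le> p" for i j
      using psd_component_le[OF psd(2)] X(1) by (meson feasible_cov_def mem_Collect_eq order_trans)
    then show ?thesis
      using rate_nonneg[OF psd(2) s, of k "H \<omega>"] rate_le[OF psd(2) s, of k p "H \<omega>"] by (simp add: w_def)
  qed
  ultimately have "(\<lambda>k. \<integral>\<omega>. rate s (X k) (H \<omega>) \<partial>Pr) \<longlonglongrightarrow> (\<integral>\<omega>. rate s Q (H \<omega>) \<partial>Pr)"
    by (intro integral_dominated_convergence[where w = w]) auto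
  then show "(capC Pr H \<sigma>2 \<circ> X) \<longlonglongrightarrow> capC Pr H \<sigma>2 Q"
    by (simp add: o_def capC_eq_rate s_def)
qed

lemma capacity_achieving_exists:
  fixes H :: "'a \<Rightarrow> complex^'n::finite^'m::finite"
  assumes "prob_space Pr" "has_cgauss_law Pr H \<Sigma>" "\<sigma>2 > 0" "p > 0"
  shows "\<exists>Q. capacity_achieving Pr H \<sigma>2 p Q"
proof -
  have "feasible_cov p (0 :: complex^'n^'n)"
    using assms(4) by (simp add: feasible_cov_def psd_iff trace_def)
  then have "{Q :: complex^'n^'n. feasible_cov p Q} \<noteq> {}" by blast
  from continuous_attains_sup[OF compact_feasible_cov this continuous_on_capC[OF assms(1-3)]]
  show ?thesis by (auto simp: capacity_achieving_def)
qed

section \<open>The Kronecker action on vectorized channels\<close>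

lemma id_kron_component: "id_kron A $ (i, k) $ (j, l) = (if i = j then A $ k $ l else 0)"
  by (simp add: id_kron_def)

lemma id_kron_mat_1: "id_kron (mat 1) = mat 1"
  by (simp add: vec_eq_iff id_kron_def mat_def prod_eq_iff)

lemma id_kron_add: "id_kron (A + B) = id_kron A + id_kron B"
  by (simp add: vec_eq_iff id_kron_def)

lemma id_kron_diff: "id_kron (A - B) = id_kron A - id_kron B"
  by (simp add: vec_eq_iff id_kron_def)

lemma cadj_id_kron: "cadj (id_kron A) = id_kron (cadj A)"
  by (auto simp: vec_eq_iff id_kron_def)

lemma id_kron_mult:
  "id_kron A ** id_kron B = (id_kron (A ** B) :: complex^('m::finite \<times> 'n::finite)^('m \<times> 'n))"
proof -
  have "(id_kron A ** id_kron B) $ (i, k) $ (j, l) = id_kron (A ** B) $ (i, k) $ (j, l)" for i j :: 'm and k l :: 'n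
  proof -
    have "(id_kron A ** id_kron B) $ (i, k) $ (j, l) =
        (\<Sum>x\<in>UNIV. \<Sum>y\<in>UNIV. id_kron A $ (i, k) $ (x, y) * id_kron B $ (x, y) $ (j, l))"
      by (simp add: matrix_matrix_mult_def sum.cartesian_product case_prod_unfold flip: UNIV_Times_UNIV)
    also have "\<dots> = (\<Sum>x\<in>UNIV. if x = i then (if i = j then (\<Sum>y\<in>UNIV. A $ k $ y * B $ y $ l) else 0) else 0)"
      by (intro sum.cong) (auto simp: id_kron_component)
    also have "\<dots> = id_kron (A ** B) $ (i, k) $ (j, l)"
      by (simp add: id_kron_component matrix_matrix_mult_def)
    finally show ?thesis .
  qed
  then show ?thesis by (auto simp: vec_eq_iff)
qed

text \<open>Right multiplication by T acts on the column index of H, and as a matrix applied from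
  the left this action is T^t. Hence the projections are taken from the transposed
  commutant.\<close>

lemma vecm_mult: "vecm (H ** T) = id_kron (transpose T) *v vecm H"
  for H :: "complex^'n::finite^'m::finite"
proof -
  have "(id_kron (transpose T) *v vecm H) $ (i, j) = vecm (H ** T) $ (i, j)" for i j
  proof -
    have "(id_kron (transpose T) *v vecm H) $ (i, j) =
        (\<Sum>x\<in>UNIV. \<Sum>y\<in>UNIV. id_kron (transpose T) $ (i, j) $ (x, y) * vecm H $ (x, y))"
      by (simp add: matrix_vector_mult_def sum.cartesian_product case_prod_unfold flip: UNIV_Times_UNIV)
    also have "\<dots> = (\<Sum>x\<in>UNIV. if x = i then (\<Sum>y\<in>UNIV. T $ y $ j * H $ i $ y) else 0)"
      by (intro sum.cong) (auto simp: id_kron_component vecm_def transpose_def)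
    also have "\<dots> = vecm (H ** T) $ (i, j)"
      by (simp add: vecm_def matrix_matrix_mult_def mult.commute)
    finally show ?thesis .
  qed
  then show ?thesis by (auto simp: vec_eq_iff)
qed

section \<open>Reflection symmetry of the capacity and averaging\<close>

lemma matrix_diff_ldistrib: "A ** (B - C) = A ** B - A ** C" for A :: "'a::ring_1^'n::finite^'m::finite"
  by (simp add: vec_eq_iff matrix_matrix_mult_def right_diff_distrib sum_subtractf)

lemma matrix_diff_rdistrib: "(A - B) ** C = A ** C - B ** C" for A :: "'a::ring_1^'n::finite^'m::finite"
  by (simp add: vec_eq_iff matrix_matrix_mult_def left_diff_distrib sum_subtractf)

text \<open>As T is Hermitian, H (T Q T) H^H = (H T) Q (H T)^H, so the reflection can be moved from
  the covariance to the channel, where it preserves the law.\<close>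

lemma capC_reflection:
  fixes H :: "'a \<Rightarrow> complex^'n::finite^'m::finite"
  assumes "has_cgauss_law Pr H \<Sigma>" and P: "is_proj P" "P \<in> transpose ` right_commutant \<Sigma>"
    and T: "T = mat 1 - (P + P)"
  shows "capC Pr H \<sigma>2 (T ** Q ** T) = capC Pr H \<sigma>2 Q"
proof -
  note alg = matrix_diff_ldistrib matrix_diff_rdistrib matrix_add_ldistrib matrix_add_rdistrib
    matrix_mul_lid matrix_mul_rid
  have P': "P ** P = P" "cadj P = P" using P(1) by (auto simp: is_proj_def)
  have TT: "T ** T = mat 1" "cadj T = T"
    by (simp_all only: T alg P' cadj_diff cadj_add cadj_mat complex_cnj_one) simp
  let ?S = "id_kron (transpose T) :: complex^('m \<times> 'n)^('m \<times> 'n)"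
  have "cadj (transpose T) = transpose (cadj T)"
    by (simp add: vec_eq_iff transpose_def)
  then have S1: "cadj ?S ** ?S = mat 1"
    by (simp add: cadj_id_kron id_kron_mult TT id_kron_mat_1 transpose_mat flip: matrix_transpose_mul)
  obtain A where A: "P = transpose A" "id_kron A ** \<Sigma> = \<Sigma> ** id_kron A"
    using P(2) by (auto simp: right_commutant_def)
  have "transpose T = mat 1 - (A + A)"
    by (simp add: T A(1) vec_eq_iff transpose_def mat_def eq_commute)
  then have S2: "?S ** \<Sigma> = \<Sigma> ** ?S"
    by (simp only: id_kron_diff id_kron_add id_kron_mat_1 alg A(2))
  \<comment> \<open>The inverse of \<open>vecm\<close> turns the rate into a function of the
    vectorized channel, whose invariance is the one available.\<close>
  define unvecm :: "complex^('m \<times> 'n) \<Rightarrow> complex^'n^'m" where "unvecm v = (\<chi> i j. v $ (i, j))" for v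
  have unvecm: "unvecm (vecm H) = H" for H
    by (simp add: unvecm_def vecm_def vec_eq_iff)
  have [measurable]: "unvecm \<in> borel \<rightarrow>\<^sub>M borel"
    unfolding unvecm_def by (intro borel_measurable_continuous_onI continuous_intros)
  define s where "s = inverse \<sigma>2"
  have "rate s (T ** Q ** T) H = rate s Q (H ** T)" for H :: "complex^'n^'m"
    by (simp add: rate_def cadj_mult TT matrix_mul_assoc)
  then have "capC Pr H \<sigma>2 (T ** Q ** T) = (\<integral>\<omega>. rate s Q (unvecm (?S *v vecm (H \<omega>))) \<partial>Pr)"
    by (simp add: capC_eq_rate s_def unvecm flip: vecm_mult)
  also have "\<dots> = (\<integral>\<omega>. rate s Q (unvecm (vecm (H \<omega>))) \<partial>Pr)"
    by (rule cgauss_law_invariant[OF assms(1) S1 S2]) measurable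
  finally show ?thesis by (simp add: unvecm capC_eq_rate s_def)
qed

text \<open>The witness (Q + T Q T) / 2 equals P Q P + (1 - P) Q (1 - P). The last conclusion lets
  the averaging be iterated: commutation with projections treated earlier is not destroyed.\<close>

lemma capacity_achieving_pinch:
  fixes H :: "'a \<Rightarrow> complex^'n::finite^'m::finite"
  assumes Pr: "prob_space Pr" and H: "has_cgauss_law Pr H \<Sigma>" and \<sigma>2: "\<sigma>2 > 0"
    and P: "is_proj P" "P \<in> transpose ` right_commutant \<Sigma>"
    and Q: "capacity_achieving Pr H \<sigma>2 p Q"
  obtains R where "capacity_achieving Pr H \<sigma>2 p R" "R ** P = P ** R"
    "\<And>C. C ** Q = Q ** C \<Longrightarrow> C ** P = P ** C \<Longrightarrow> C ** R = R ** C"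
proof
  define T where "T = mat 1 - (P + P)"
  let ?R = "(1/2) *\<^sub>R (Q + T ** Q ** T)"
  note alg = matrix_diff_ldistrib matrix_diff_rdistrib matrix_add_ldistrib matrix_add_rdistrib
    matrix_mul_lid matrix_mul_rid
  have P': "P ** P = P" "cadj P = P" using P(1) by (auto simp: is_proj_def)
  have T: "T ** T = mat 1" "cadj T = T"
    by (simp_all only: T_def alg P' cadj_diff cadj_add cadj_mat complex_cnj_one) simp
  have Q': "psd Q" "Re (trace Q) \<le> p"
    using Q by (auto simp: capacity_achieving_def feasible_cov_def)
  have psdT: "psd (T ** Q ** T)"
    using psd_congruence[OF Q'(1), of T] by (simp add: T)
  have "trace (T ** Q ** T) = trace Q"
    by (metis T(1) matrix_mul_assoc matrix_mul_lid trace_mul_sym)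
  then have "Re (trace ?R) = Re (trace Q)"
    by (simp add: trace_def sum.distrib flip: sum_divide_distrib scaleR_sum_right)
  then have feas: "feasible_cov p ?R"
    using Q' psdT by (simp add: feasible_cov_def psd_add psd_scaleR del: scaleR_right_distrib)
  have s: "0 \<le> inverse \<sigma>2" using \<sigma>2 by simp
  have psdR: "psd ?R" using feas by (simp add: feasible_cov_def)
  note int = integrable_rate[OF Pr H _ s]
  have "capC Pr H \<sigma>2 Q = (capC Pr H \<sigma>2 Q + capC Pr H \<sigma>2 (T ** Q ** T)) / 2"
    by (simp add: capC_reflection[OF H P T_def])
  also have "\<dots> = (\<integral>\<omega>. (rate (inverse \<sigma>2) Q (H \<omega>) + rate (inverse \<sigma>2) (T ** Q ** T) (H \<omega>)) / 2 \<partial>Pr)"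
    by (simp add: capC_eq_rate int Q' psdT)
  also have "\<dots> \<le> capC Pr H \<sigma>2 ?R"
    unfolding capC_eq_rate
    by (intro integral_mono integrable_divide Bochner_Integration.integrable_add int Q' psdT psdR
        rate_midpoint_concave s)
  finally show "capacity_achieving Pr H \<sigma>2 p ?R"
    using Q feas unfolding capacity_achieving_def by (meson order_trans)
  have XPP: "X ** P ** P = X ** P" for X
    by (simp add: P' flip: matrix_mul_assoc)
  \<comment> \<open>Both sides equal 2 P Q P, since P T = T P = - P.\<close>
  have "P ** (Q + T ** Q ** T) = (Q + T ** Q ** T) ** P"
    by (simp only: T_def alg matrix_mul_assoc P' XPP) (simp add: algebra_simps)
  then show "?R ** P = P ** ?R"
    by (simp only: matrix_scaleR_left matrix_scaleR_right)
  show "C ** ?R = ?R ** C" if "C ** Q = Q ** C" "C ** P = P ** C" for C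
  proof -
    have "C ** T = T ** C" by (simp only: T_def alg that(2))
    then have "C ** (T ** Q ** T) = T ** Q ** T ** C"
      by (metis that(1) matrix_mul_assoc)
    then show ?thesis
      by (simp only: matrix_scaleR_left matrix_scaleR_right alg that(1))
  qed
qed

section \<open>Block structure in the basis U and conclusion\<close>

lemma matrix_entry_column: "(cadj U ** Q ** U) $ a $ b = (\<Sum>i\<in>UNIV. cnj (column a U $ i) * (Q *v column b U) $ i)"
proof -
  have "(cadj U ** Q ** U) $ a $ b = (cadj U ** (Q ** U)) $ a $ b"
    by (simp add: matrix_mul_assoc)
  also have "\<dots> = (\<Sum>i\<in>UNIV. cnj (column a U $ i) * (Q *v column b U) $ i)"
    by (simp add: matrix_matrix_mult_def matrix_vector_mult_def column_def)
  finally show ?thesis .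
qed

text \<open>The entry pairs column a with Q applied to column b. As Q commutes with R, the latter
  vector stays in the range of R and is killed by P, and P may be inserted because it is Hermitian
  and fixes column a.\<close>

lemma block_diagonal_entry:
  fixes Q U :: "complex^'n::finite^'n"
  assumes P: "cadj P = P" "P ** R = 0" "Q ** R = R ** Q"
    and a: "P *v column a U = column a U" and b: "R *v column b U = column b U"
  shows "(cadj U ** Q ** U) $ a $ b = 0"
proof -
  have "P *v (Q *v column b U) = P *v (Q *v (R *v column b U))"
    by (simp only: b)
  also have "\<dots> = ((P ** R) ** Q) *v column b U"
    by (simp only: P(3) matrix_vector_mul_assoc flip: matrix_mul_assoc)
  finally have z: "P *v (Q *v column b U) = 0"
    unfolding P(2) by (simp add: vec_eq_iff matrix_vector_mult_def matrix_matrix_mult_def)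
  have "(cadj U ** Q ** U) $ a $ b = (\<Sum>i\<in>UNIV. cnj ((P *v column a U) $ i) * (Q *v column b U) $ i)"
    unfolding a by (rule matrix_entry_column)
  also have "\<dots> = 0"
    unfolding sum_cnj_matrix_vector_cadj P(1) z by simp
  finally show ?thesis .
qed

text \<open>The index type carries no order, so a block is a class of columns with the same label
  \<open>blk\<close>. The columns labelled j are orthonormal and span the range of
  \<open>P j\<close>, so the block has size tr (P_j); block diagonality says that U^H Q U vanishes
  between different labels.\<close>

theorem theorem3:
  fixes Pr :: "'a measure"
    and H :: "'a \<Rightarrow> complex^'n^'m"
    and \<Sigma> :: "complex^('m \<times> 'n)^('m \<times> 'n)"
    and \<sigma>2 p :: real
    and c :: nat
    and P :: "nat \<Rightarrow> complex^'n^'n"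
    and U :: "complex^'n^'n"
    and blk :: "'n \<Rightarrow> nat"
  assumes "prob_space Pr"
    and "has_cgauss_law Pr H \<Sigma>"
    and "\<sigma>2 > 0" and "p > 0"
    and "right_commutant \<Sigma> \<noteq> range (\<lambda>z::complex. mat z)"
    and "c \<ge> 1"
    and "\<forall>j\<in>{1..c}. minimal_proj_in (transpose ` right_commutant \<Sigma>) (P j)"
    and "\<forall>j\<in>{1..c}. \<forall>k\<in>{1..c}. j \<noteq> k \<longrightarrow> P j ** P k = 0"
    and "(\<Sum>j=1..c. P j) = mat 1"
    and "unitary U"
    and "\<forall>a. blk a \<in> {1..c}"
    and "\<forall>j\<in>{1..c}. {P j *v x | x. True} =
            {(\<Sum>a\<in>{a. blk a = j}. f a *s column a U) | f. True}"
  shows "\<exists>Q. capacity_achieving Pr H \<sigma>2 p Q \<and>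
             (\<forall>a b. blk a \<noteq> blk b \<longrightarrow> (cadj U ** Q ** U) $ a $ b = 0) \<and>
             (\<forall>j\<in>{1..c}. Q ** P j = P j ** Q)"
proof -
  have P: "is_proj (P j)" "P j \<in> transpose ` right_commutant \<Sigma>" if "j \<in> {1..c}" for j
    using assms(7) that by (auto simp: minimal_proj_in_def)
  have commute: "P j ** P k = P k ** P j" if "j \<in> {1..c}" "k \<in> {1..c}" for j k
    using assms(8) that by (cases "j = k") auto
  \<comment> \<open>Induction on the number of projections already averaged over. Since the
    \<open>P j\<close> commute with each other, each new average keeps the commutation relations
    obtained before.\<close>
  have "\<exists>Q. capacity_achieving Pr H \<sigma>2 p Q \<and> (\<forall>j\<in>{1..k}. Q ** P j = P j ** Q)" if "k \<le> c" for k
    using that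
  proof (induction k)
    case 0
    then show ?case using capacity_achieving_exists[OF assms(1-4)] by simp
  next
    case (Suc k)
    then obtain Q where Q: "capacity_achieving Pr H \<sigma>2 p Q" "\<forall>j\<in>{1..k}. Q ** P j = P j ** Q"
      by auto
    have k: "Suc k \<in> {1..c}" using Suc.prems by simp
    obtain R where R: "capacity_achieving Pr H \<sigma>2 p R" "R ** P (Suc k) = P (Suc k) ** R"
      "\<And>C. C ** Q = Q ** C \<Longrightarrow> C ** P (Suc k) = P (Suc k) ** C \<Longrightarrow> C ** R = R ** C"
      using capacity_achieving_pinch[OF assms(1-3) P(1)[OF k] P(2)[OF k] Q(1)] by blast
    have "R ** P j = P j ** R" if "j \<in> {1..Suc k}" for j
    proof (cases "j = Suc k")
      case False
      with that have j: "j \<in> {1..k}" "j \<in> {1..c}" using Suc.prems by auto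
      then have "P j ** R = R ** P j"
        using Q(2) commute[OF j(2) k] by (intro R(3)) auto
      then show ?thesis ..
    qed (use R(2) in simp)
    with R(1) show ?case by blast
  qed
  then obtain Q where Q: "capacity_achieving Pr H \<sigma>2 p Q" "\<forall>j\<in>{1..c}. Q ** P j = P j ** Q"
    by blast
  \<comment> \<open>A column is a trivial linear combination of the columns with its own label
    (coefficient 1 at \<open>a\<close>, 0 elsewhere). It therefore lies in the range of
    \<open>P (blk a)\<close>, and a projection fixes its range pointwise.\<close>
  have col: "P (blk a) *v column a U = column a U" for a
  proof -
    have "(\<Sum>b\<in>{b. blk b = blk a}. (if b = a then 1 else 0) *s column b U) = (\<Sum>b\<in>{b. blk b = blk a}. if b = a then column b U else 0)"
      by (intro sum.cong) auto
    also have "\<dots> = column a U"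
      by simp
    finally have "column a U = (\<Sum>b\<in>{b. blk b = blk a}. (if b = a then 1 else 0) *s column b U)" ..
    then have "column a U \<in> {(\<Sum>b\<in>{b. blk b = blk a}. f b *s column b U) | f. True}"
      by (intro CollectI exI[of _ "\<lambda>b. if b = a then 1 else 0"] conjI TrueI)
    then have "column a U \<in> {P (blk a) *v x | x. True}"
      using assms(12)[rule_format, of "blk a"] assms(11) by (simp only:)
    then obtain x where "column a U = P (blk a) *v x" by blast
    moreover have "P (blk a) ** P (blk a) = P (blk a)"
      using P(1) assms(11) by (auto simp: is_proj_def)
    ultimately show ?thesis by (simp add: matrix_vector_mul_assoc)
  qed
  have "(cadj U ** Q ** U) $ a $ b = 0" if "blk a \<noteq> blk b" for a b
    by (rule block_diagonal_entry[of "P (blk a)" "P (blk b)"])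
       (use that P(1) assms(8,11) Q(2) col in \<open>auto simp: is_proj_def\<close>)
  with Q show ?thesis by blast
qed

end
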